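(* Let $N$ be an $n$-bit composite integer and let $m=\lceil n/2\rceil$. Let $$S_N(p)=\sum_{q\in\{0,1\}^{m}} M_N(p,q)\,B(p,q),\qquad p\in\{0,1\}^{n-1},$$ where $M_N(p,q)=\mathbf{1}[pq=N]$ (the network enforces exact integer multiplication $pq=N$), and where $B:\{0,1\}^{n-1}\times\{0,1\}^{m}\to\{0,1\}$ is an admissibility selector that allows nontrivial auxiliary values $q$, i.e. $B(p,q)=1$ whenever $pq=N$ and $1<q<N$. Then $S_N$ has nonempty support. Moreover, provided the admissibility constraints exclude $p=1$, $p=N$, $q=0$ and $q=1$ (i.e. $B(p,q)=0$ whenever $p\in\{1,N\}$ or $q\in\{0,1\}$), every $p\in\operatorname{supp}S_N$ is a nontrivial divisor of $N$.
   Context: Bit strings are identified with the nonnegative integers they represent in binary, so $p\in\{0,1\}^{n-1}$ ranges over $0\le p<2^{n-1}$ and $q\in\{0,1\}^m$ ranges over $0\le q<2^m$. An $n$-bit integer $N$ is one with $2^{n-1}\le N<2^n$. $\mathbf{1}[\cdot]$ is $1$ if the condition holds and $0$ otherwise. The relation $M_N$ arises from the tensor $T(p,q,y)=\mathbf{1}[y=pq]$, with $y\in\{0,1\}^W$ an output register wide enough to represent the full product $pq$, by projecting $y$ onto the binary expansion of $N$ padded with leading zeros: $M_N(p,q)=\sum_y T(p,q,y)\prod_{i=0}^{W-1}\delta_{y_i,N_i}=\mathbf{1}[pq=N]$. The support is $\operatorname{supp}S_N=\{p: S_N(p)\neq 0\}=\{p:\exists\, q<2^m,\ pq=N,\ B(p,q)=1\}$.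 A nontrivial divisor of $N$ is a divisor $d$ with $1<d<N$. *)

theory Defs
  imports Complex_Main "HOL-Computational_Algebra.Primes"
begin

text \<open>Bit strings of length \<open>k\<close> are represented by the natural numbers below \<open>2 ^ k\<close>;
  tensor entries are natural numbers.\<close>

definition n_bit :: "nat \<Rightarrow> nat \<Rightarrow> bool" where
  "n_bit n N \<longleftrightarrow> 2 ^ (n - 1) \<le> N \<and> N < 2 ^ n"

definition composite :: "nat \<Rightarrow> bool" where
  "composite N \<longleftrightarrow> 1 < N \<and> \<not> prime N"

definition nontrivial_divisor :: "nat \<Rightarrow> nat \<Rightarrow> bool" where
  "nontrivial_divisor d N \<longleftrightarrow> d dvd N \<and> 1 < d \<and> d < N"

definition mult_rel :: "nat \<Rightarrow> nat \<Rightarrow> nat \<Rightarrow> nat" where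
  "mult_rel N p q = of_bool (p * q = N)"

definition mult_tensor :: "nat \<Rightarrow> nat \<Rightarrow> nat \<Rightarrow> nat" where
  "mult_tensor p q y = of_bool (y = p * q)"

text \<open>\<open>mult_rel N\<close> is the multiplication tensor with its \<open>W\<close>-bit output register projected
  onto the binary expansion of \<open>N\<close>.\<close>

lemma mult_rel_eq_projected_tensor:
  assumes "p * q < 2 ^ W" and "N < 2 ^ W"
  shows "mult_rel N p q =
    (\<Sum>y<2 ^ W. mult_tensor p q y * (\<Prod>i<W. of_bool (bit y i = bit N i)))"
proof -
  have eq: "(\<Prod>i<W. of_bool (bit y i = bit N i)) = (of_bool (y = N) :: nat)"
    if "y < 2 ^ W" for y
  proof (cases "y = N")
    case False
    have "\<exists>i<W. bit y i \<noteq> bit N i"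
    proof (rule ccontr)
      assume "\<not> ?thesis"
      then have "take_bit W y = take_bit W N"
        by (auto intro!: bit_eqI simp: bit_take_bit_iff)
      with that assms(2) False show False
        by (simp add: take_bit_nat_eq_self)
    qed
    with False show ?thesis
      by auto
  qed simp
  have "(\<Sum>y<2 ^ W. mult_tensor p q y * (\<Prod>i<W. of_bool (bit y i = bit N i)))
      = (\<Sum>y<2 ^ W. if y = p * q then of_bool (y = N) else 0)"
    by (rule sum.cong) (auto simp: mult_tensor_def eq)
  also have "\<dots> = mult_rel N p q"
    using assms(1) by (simp add: mult_rel_def)
  finally show ?thesis ..
qed

definition S :: "nat \<Rightarrow> nat \<Rightarrow> (nat \<Rightarrow> nat \<Rightarrow> nat) \<Rightarrow> nat \<Rightarrow> nat" where
  "S m N B p = (\<Sum>q<2 ^ m. mult_rel N p q * B p q)"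

definition supp_S :: "nat \<Rightarrow> nat \<Rightarrow> nat \<Rightarrow> (nat \<Rightarrow> nat \<Rightarrow> nat) \<Rightarrow> nat set" where
  "supp_S n m N B = {p. p < 2 ^ (n - 1) \<and> S m N B p \<noteq> 0}"

end

theory Submission
  imports Defs
begin

text \<open>Membership of \<open>p\<close> in the support means that \<open>p\<close> has an admissible cofactor \<open>q\<close> below
  \<open>2 ^ m\<close>. For nonemptiness, split the composite number as \<open>N = p * q\<close> with \<open>1 < q \<le> p\<close>. The
  smaller factor satisfies \<open>q\<^sup>2 \<le> N < 2 ^ n \<le> (2 ^ m)\<^sup>2\<close>, because \<open>m\<close> is half of \<open>n\<close> rounded
  up, so it fits into the \<open>m\<close>-bit register; the larger one is at most \<open>N / 2 < 2 ^ (n - 1)\<close>, so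
  it fits into \<open>n - 1\<close> bits. The selector admits this pair. Conversely, any \<open>p\<close> in the support
  divides \<open>N\<close>, and once the selector rejects \<open>1\<close> and \<open>N\<close> the divisor can only be nontrivial.\<close>

lemma composite_splitE:
  assumes "composite N"
  obtains p q where "p * q = N" and "1 < q" and "q \<le> p"
proof -
  from assms have "1 < N" and "\<not> prime N"
    by (auto simp: composite_def)
  then obtain d where d: "d dvd N" "d \<noteq> 1" "d \<noteq> N"
    by (auto simp: prime_nat_iff)
  from d(1) obtain e where e: "N = d * e" ..
  with d \<open>1 < N\<close> have "1 < d" "1 < e"
    by (auto simp: nat_neq_iff)
  with e that[of d e] that[of e d] show thesis
    by (cases "e \<le> d") (auto simp: mult.commute)
qed

lemma smaller_factor_less_power:
  fixes p q :: nat
  assumes "p * q < 2 ^ n" and "q \<le> p"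
  shows "q < 2 ^ nat \<lceil>real n / 2\<rceil>"
proof (rule power2_less_imp_less)
  have "n \<le> 2 * nat \<lceil>real n / 2\<rceil>"
    by linarith
  then have "(2::nat) ^ n \<le> (2 ^ nat \<lceil>real n / 2\<rceil>)\<^sup>2"
    by (simp add: power_increasing flip: power_mult mult.commute[of 2])
  moreover have "q\<^sup>2 \<le> p * q"
    using assms(2) by (simp add: power2_eq_square)
  ultimately show "q\<^sup>2 < (2 ^ nat \<lceil>real n / 2\<rceil>)\<^sup>2"
    using assms(1) by linarith
qed simp

lemma cofactor_less_half_power:
  fixes p q :: nat
  assumes "p * q < 2 ^ n" and "1 < q"
  shows "p < 2 ^ (n - 1)"
proof -
  have "2 * p \<le> p * q"
    using assms(2) by simp
  with assms(1) have "2 * p < 2 ^ n"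
    by linarith
  then show ?thesis
    by (cases n) auto
qed

text \<open>The entries are natural numbers, so no cancellation can occur in the sum over \<open>q\<close>, and its
  nonvanishing is witnessed by a single term.\<close>

lemma supp_S_iff:
  "p \<in> supp_S n m N B \<longleftrightarrow>
    p < 2 ^ (n - 1) \<and> (\<exists>q<2 ^ m. p * q = N \<and> B p q \<noteq> 0)"
  by (auto simp: supp_S_def S_def mult_rel_def)

theorem theorem3p2:
  fixes n m N :: nat and B :: "nat \<Rightarrow> nat \<Rightarrow> nat"
  assumes "n_bit n N" and "composite N"
    and "m = nat \<lceil>real n / 2\<rceil>"
    and "\<forall>p<2 ^ (n - 1). \<forall>q<2 ^ m. B p q \<in> {0, 1}"
    and "\<forall>p<2 ^ (n - 1). \<forall>q<2 ^ m. p * q = N \<and> 1 < q \<and> q < N \<longrightarrow> B p q = 1"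
  shows "supp_S n m N B \<noteq> {} \<and>
    ((\<forall>p<2 ^ (n - 1). \<forall>q<2 ^ m. p \<in> {1, N} \<or> q \<in> {0, 1} \<longrightarrow> B p q = 0) \<longrightarrow>
      (\<forall>p\<in>supp_S n m N B. nontrivial_divisor p N))"
proof (intro conjI impI ballI)
  from assms(2) obtain p q where pq: "p * q = N" "1 < q" "q \<le> p"
    by (rule composite_splitE)
  from assms(1) pq(1) have less: "p * q < 2 ^ n"
    by (simp add: n_bit_def)
  have "p < 2 ^ (n - 1)"
    using less pq(2) by (rule cofactor_less_half_power)
  moreover have "q < 2 ^ m"
    unfolding assms(3) using less pq(3) by (rule smaller_factor_less_power)
  moreover have "q < N"
    using pq by auto
  ultimately have "p \<in> supp_S n m N B"
    using assms(5) pq by (auto simp: supp_S_iff)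
  then show "supp_S n m N B \<noteq> {}"
    by blast
next
  fix p
  assume excl: "\<forall>p<2 ^ (n - 1). \<forall>q<2 ^ m. p \<in> {1, N} \<or> q \<in> {0, 1} \<longrightarrow> B p q = 0"
    and "p \<in> supp_S n m N B"
  then obtain q where "p < 2 ^ (n - 1)" "q < 2 ^ m" "p * q = N" "B p q \<noteq> 0"
    by (auto simp: supp_S_iff)
  with excl have "p \<noteq> 1" "p \<noteq> N" "p dvd N"
    by auto
  moreover have "0 < N"
    using assms(2) by (simp add: composite_def)
  ultimately show "nontrivial_divisor p N"
    using dvd_imp_le[of p N] dvd_pos_nat[of N p] by (auto simp: nontrivial_divisor_def)
qed

end
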